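(* Let $L:\mathbb{R}^d\to\mathbb{R}_+$ be symmetric and quasiconvex with $L(0)=0$, let $\mathcal{P}$ be a family of distributions on $\mathcal{X}$ with parameter $\theta:\mathcal{P}\to\Theta\subset\mathbb{R}^d$, and let $\mathcal{Q}$ be the collection of (sequentially interactive) $(2,\varepsilon^2)$-locally Rényi differentially private channels. Let $c_{\mathrm{conv}}=1$ if $L$ is convex and $c_{\mathrm{conv}}=2$ otherwise. Then for any distribution $P_0\in\mathcal{P}$ and every $n\in\mathbb{N}$, $$\mathfrak{M}^{\mathrm{loc}}_n(P_0,L,\mathcal{P},\mathcal{Q})\ \ge\ \frac{1}{4c_{\mathrm{conv}}}\,\omega_L\!\left(\frac{1}{2\sqrt{2n\varepsilon^2}};P_0,\mathcal{P}\right).$$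
   Context: Data $X_1,\dots,X_n$ are i.i.d. from $P$ on $\mathcal{X}$. A sequentially interactive channel $Q$ produces private observations $Z_1,\dots,Z_n\in\mathcal{Z}$ via Markov kernels: $Z_i\mid X_i=x,Z_{1:i-1}=z_{1:i-1}\sim Q(\cdot\mid x,z_{1:i-1})$. The channel is $(2,\varepsilon^2)$-Rényi locally differentially private if for all $i$, all $x,x'\in\mathcal{X}$ and all $z_{1:i-1}$, $D_2(Q(\cdot\mid x,z_{1:i-1})\|Q(\cdot\mid x',z_{1:i-1}))\le\varepsilon^2$, where $D_2(P\|Q)=\log\int(dP/dQ)^2dQ$. Symmetric means $L(-t)=L(t)$. The local minimax risk is $$\mathfrak{M}^{\mathrm{loc}}_n(P_0,L,\mathcal{P},\mathcal{Q})=\sup_{P_1\in\mathcal{P}}\ \inf_{\hat\theta,\,Q\in\mathcal{Q}}\ \max_{P\in\{P_0,P_1\}}\mathbb{E}_{Q\circ P}\big[L(\hat\theta(Z_1,\dots,Z_n)-\theta(P))\big],$$ where $Q\circ P$ denotes the law of $Z_{1:n}$ when $X_i\overset{iid}{\sim}P$ and $Z_i$ are drawn from $Q$, and the infimum is over all estimators $\hat\theta$ (measurable functions of $Z_{1:n}$). The modulus of continuity is $$\omega_L(\delta;P_0,\mathcal{P})=\sup_{P\in\mathcal{P}}\Big\{L\Big(\frac{\theta(P_0)-\theta(P)}{2}\Big)\ :\ \|P-P_0\|_{TV}\le\delta\Big\},\qquad \|P-P_0\|_{TV}=\sup_A|P(A)-P_0(A)|.$$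
   Formalization: The formal theorem assumes 0 < ε ≤ 1, since with D_2 as defined the bound fails for large ε (e.g. ε² ≈ 8.23, n = 1500, binary data); it also takes L Borel measurable and n ≥ 1 so that the risk and the radius are defined. *)

theory Defs
  imports "HOL-Probability.Probability"
begin

definition quasiconvex :: "('a::real_vector \<Rightarrow> real) \<Rightarrow> bool" where
  "quasiconvex L \<longleftrightarrow>
     (\<forall>x y. \<forall>t\<in>{0..1}. L ((1 - t) *\<^sub>R x + t *\<^sub>R y) \<le> max (L x) (L y))"

definition c_conv :: "('a::real_vector \<Rightarrow> real) \<Rightarrow> real" where
  "c_conv L = (if convex_on UNIV L then 1 else 2)"

text \<open>Both arguments are meant to be probability measures on the same measurable space, so that
  the supremum is over a nonempty subset of the unit interval.\<close>

definition tv_dist :: "'a measure \<Rightarrow> 'a measure \<Rightarrow> real" where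
  "tv_dist P Q = (SUP A\<in>sets P. \<bar>measure P A - measure Q A\<bar>)"

text \<open>The Renyi divergence of order 2. It is infinite when \<open>P\<close> is not dominated by \<open>Q\<close> or
  the integral diverges. Mind the argument order in the library: \<open>absolutely_continuous Q P\<close>
  says that \<open>P\<close> is dominated by \<open>Q\<close>, and \<open>RN_deriv Q P\<close> is \<open>dP/dQ\<close>.\<close>

definition renyi_div2 :: "'a measure \<Rightarrow> 'a measure \<Rightarrow> ereal" where
  "renyi_div2 P Q =
     (let I = (\<integral>\<^sup>+ z. (RN_deriv Q P z)\<^sup>2 \<partial>Q) in
      if absolutely_continuous Q P \<and> I < \<infinity> then ereal (ln (enn2real I)) else \<infinity>)"

text \<open>Rounds are numbered from 0: \<open>Q i x z\<close> is the conditional law of observation number \<open>i\<close> given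
  that the datum of round \<open>i\<close> is \<open>x\<close> and the observations of the rounds \<open>{..<i}\<close> are \<open>z\<close>.\<close>

type_synonym ('x, 'z) channel = "nat \<Rightarrow> 'x \<Rightarrow> (nat \<Rightarrow> 'z) \<Rightarrow> 'z measure"

definition seq_channels :: "'x measure \<Rightarrow> 'z measure \<Rightarrow> nat \<Rightarrow> ('x, 'z) channel set" where
  "seq_channels MX MZ n =
     {Q. \<forall>i<n. (\<lambda>(x, z). Q i x z) \<in> MX \<Otimes>\<^sub>M Pi\<^sub>M {..<i} (\<lambda>_. MZ) \<rightarrow>\<^sub>M prob_algebra MZ}"

definition renyi2_private_channels ::
    "'x measure \<Rightarrow> 'z measure \<Rightarrow> nat \<Rightarrow> real \<Rightarrow> ('x, 'z) channel set" where
  "renyi2_private_channels MX MZ n \<rho> =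
     {Q \<in> seq_channels MX MZ n.
        \<forall>i<n. \<forall>x\<in>space MX. \<forall>x'\<in>space MX. \<forall>z\<in>space (Pi\<^sub>M {..<i} (\<lambda>_. MZ)).
          renyi_div2 (Q i x z) (Q i x' z) \<le> ereal \<rho>}"

text \<open>The law of the first \<open>n\<close> observations when the data are the fixed sequence \<open>x\<close>.\<close>

primrec cond_obs_law ::
    "'z measure \<Rightarrow> ('x, 'z) channel \<Rightarrow> (nat \<Rightarrow> 'x) \<Rightarrow> nat \<Rightarrow> (nat \<Rightarrow> 'z) measure" where
  "cond_obs_law MZ Q x 0 = return (Pi\<^sub>M {..<0} (\<lambda>_. MZ)) (\<lambda>_. undefined)"
| "cond_obs_law MZ Q x (Suc i) =
     cond_obs_law MZ Q x i \<bind>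
       (\<lambda>z. distr (Q i (x i) z) (Pi\<^sub>M {..<Suc i} (\<lambda>_. MZ)) (\<lambda>w. z(i := w)))"

definition obs_law ::
    "'z measure \<Rightarrow> nat \<Rightarrow> ('x, 'z) channel \<Rightarrow> 'x measure \<Rightarrow> (nat \<Rightarrow> 'z) measure" where
  "obs_law MZ n Q P = Pi\<^sub>M {..<n} (\<lambda>_. P) \<bind> (\<lambda>x. cond_obs_law MZ Q x n)"

definition risk ::
    "'z measure \<Rightarrow> nat \<Rightarrow> ('x measure \<Rightarrow> 'e) \<Rightarrow> ('e \<Rightarrow> real) \<Rightarrow>
     ((nat \<Rightarrow> 'z) \<Rightarrow> 'e::real_vector) \<Rightarrow> ('x, 'z) channel \<Rightarrow> 'x measure \<Rightarrow> ennreal" where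
  "risk MZ n \<theta> L est Q P = (\<integral>\<^sup>+ z. ennreal (L (est z - \<theta> P)) \<partial>obs_law MZ n Q P)"

definition local_minimax_risk ::
    "'z measure \<Rightarrow> nat \<Rightarrow> ('x measure \<Rightarrow> 'e::euclidean_space) \<Rightarrow> 'x measure \<Rightarrow> ('e \<Rightarrow> real) \<Rightarrow>
     'x measure set \<Rightarrow> ('x, 'z) channel set \<Rightarrow> ennreal" where
  "local_minimax_risk MZ n \<theta> P0 L \<P> \<Q> =
     (SUP P1\<in>\<P>. INF (est, Q) \<in> (Pi\<^sub>M {..<n} (\<lambda>_. MZ) \<rightarrow>\<^sub>M borel) \<times> \<Q>.
        max (risk MZ n \<theta> L est Q P0) (risk MZ n \<theta> L est Q P1))"

definition modulus ::
    "('x measure \<Rightarrow> 'e::real_vector) \<Rightarrow> ('e \<Rightarrow> real) \<Rightarrow> real \<Rightarrow> 'x measure \<Rightarrow>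
     'x measure set \<Rightarrow> ennreal" where
  "modulus \<theta> L \<delta> P0 \<P> =
     (SUP P \<in> {P \<in> \<P>. tv_dist P P0 \<le> \<delta>}. ennreal (L ((\<theta> P0 - \<theta> P) /\<^sub>R 2)))"

end

theory Submission
  imports Defs
begin

text \<open>
  The bound is a two-point argument. For \<open>P\<^sub>1\<close> within total variation \<open>\<delta>\<close> of \<open>P\<^sub>0\<close>, privacy makes
  the laws \<open>M\<^sub>1\<close> and \<open>M\<^sub>0\<close> of the observations so close that no estimator can tell them apart
  reliably, and an estimate that is good for one parameter is bad for the other
  (\<open>loss_separation\<close>).

  Closeness is measured by the least \<open>C\<close> such that \<open>(\<integral> f dM\<^sub>1)\<^sup>2 \<le> C \<cdot> \<integral> f\<^sup>2 dM\<^sub>0\<close> for all bounded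
  measurable \<open>f\<close>, that is, by one plus the chi-square divergence, in a form without densities.

  In a single round, two inputs lead to output laws with chi-square divergence at most
  \<open>c = exp (\<epsilon>\<^sup>2) - 1\<close> (\<open>chi2_bound_renyi_div2\<close>). Averaging the outputs over the unknown
  datum lowers this to \<open>4 \<delta>\<^sup>2 c\<close>: expected outputs as a function of the input oscillate little
  because of privacy, and the two input laws differ little in total variation, so both effects
  multiply (\<open>chi2_bound_mixture\<close>). As the data are independent, the observations form a process
  whose transitions are these averaged kernels (\<open>obs_law_Suc\<close>), and the constants
  \<open>1 + 4 \<delta>\<^sup>2 c\<close> of the rounds multiply along it (\<open>second_moment_bound_bind\<close>). For the given radius
  the product over \<open>n\<close> rounds is at most \<open>(1 + 1/n)\<^sup>n \<le> e \<le> 3\<close>.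

  Finally, \<open>C \<le> 3\<close> forces the sum of the two risks to be at least a quarter of the minimal
  total loss \<open>L (t - \<theta> P\<^sub>0) + L (t - \<theta> P\<^sub>1)\<close> (\<open>quarter_le_two_point\<close>), and the larger risk is at
  least half of the sum.
\<close>

section \<open>Integrals of bounded functions\<close>

lemma (in finite_measure) integrable_bounded_image:
  fixes g :: "'a \<Rightarrow> real"
  assumes "g \<in> borel_measurable M" "bounded (g ` space M)"
  shows "integrable M g"
proof -
  obtain B where "\<And>x. x \<in> space M \<Longrightarrow> norm (g x) \<le> B"
    using assms(2) by (auto simp: bounded_iff)
  then show ?thesis
    using assms(1) by (intro integrable_const_bound[of _ B]) auto
qed

lemma bounded_image_power2:
  fixes g :: "'a \<Rightarrow> real"
  assumes "bounded (g ` S)"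
  shows "bounded ((\<lambda>x. (g x)\<^sup>2) ` S)"
proof -
  obtain B where "\<forall>x\<in>S. norm (g x) \<le> B"
    using assms by (auto simp: bounded_iff)
  then have "\<forall>x\<in>S. norm ((g x)\<^sup>2) \<le> B\<^sup>2"
    by (metis norm_ge_zero norm_power power_mono)
  then show ?thesis
    by (auto simp: bounded_iff)
qed

lemma bounded_image_diff_const:
  fixes g :: "'a \<Rightarrow> real"
  assumes "bounded (g ` S)"
  shows "bounded ((\<lambda>x. g x - m) ` S)"
proof -
  obtain B where "\<forall>x\<in>S. norm (g x) \<le> B"
    using assms by (auto simp: bounded_iff)
  then have "\<forall>x\<in>S. norm (g x - m) \<le> B + norm m"
    by (meson add_mono norm_triangle_ineq4 order_refl order_trans)
  then show ?thesis
    by (auto simp: bounded_iff)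
qed

lemma integral_Cauchy_Schwarz:
  fixes f g :: "'a \<Rightarrow> real"
  assumes f: "integrable M (\<lambda>x. (f x)\<^sup>2)" and g: "integrable M (\<lambda>x. (g x)\<^sup>2)"
    and fg: "integrable M (\<lambda>x. f x * g x)"
  shows "(\<integral>x. f x * g x \<partial>M)\<^sup>2 \<le> (\<integral>x. (f x)\<^sup>2 \<partial>M) * (\<integral>x. (g x)\<^sup>2 \<partial>M)"
proof -
  define a b p where "a = (\<integral>x. (f x)\<^sup>2 \<partial>M)" and "b = (\<integral>x. (g x)\<^sup>2 \<partial>M)"
    and "p = (\<integral>x. f x * g x \<partial>M)"
  have quad: "0 \<le> a * t\<^sup>2 - 2 * t * p + b" for t
  proof -
    have "0 \<le> (\<integral>x. (t * f x - g x)\<^sup>2 \<partial>M)"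
      by simp
    also have "\<dots> = (\<integral>x. t\<^sup>2 * (f x)\<^sup>2 - 2 * t * (f x * g x) + (g x)\<^sup>2 \<partial>M)"
      by (simp add: power2_eq_square algebra_simps)
    also have "\<dots> = a * t\<^sup>2 - 2 * t * p + b"
      using f g fg by (simp add: a_def b_def p_def mult.commute)
    finally show ?thesis .
  qed
  have "a \<ge> 0"
    by (simp add: a_def)
  have "p\<^sup>2 \<le> a * b"
  proof (cases "a = 0")
    case True
    have "p = 0"
    proof (rule ccontr)
      assume "p \<noteq> 0"
      then show False
        \<comment> \<open>At this point the quadratic takes the value \<open>- 1\<close>.\<close>
        using quad[of "(b + 1) / (2 * p)"] True by (simp add: field_simps)
    qed
    then show ?thesis
      using True by simp
  next
    case False
    then show ?thesis
      \<comment> \<open>The minimiser of the quadratic.\<close>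
      using quad[of "p / a"] \<open>a \<ge> 0\<close> by (simp add: field_simps power2_eq_square)
  qed
  then show ?thesis
    by (simp add: a_def b_def p_def)
qed

lemma integral_bind_prob_algebra:
  fixes f :: "'b \<Rightarrow> real"
  assumes P: "P \<in> space (prob_algebra M)" and K: "K \<in> M \<rightarrow>\<^sub>M prob_algebra N"
    and f: "f \<in> borel_measurable N" and bdd: "bounded (f ` space N)"
  shows "integral\<^sup>L (P \<bind> K) f = (\<integral>x. integral\<^sup>L (K x) f \<partial>P)"
proof -
  have "sets P = sets M" and "prob_space P"
    using P by (auto simp: space_prob_algebra)
  interpret P: prob_space P by fact
  have K': "K \<in> P \<rightarrow>\<^sub>M prob_algebra N"
    using K measurable_cong_sets[OF \<open>sets P = sets M\<close> refl] by auto
  obtain B where "\<And>x. x \<in> space N \<Longrightarrow> norm (f x) \<le> B"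
    using bdd by (auto simp: bounded_iff)
  moreover have "AE x in P. emeasure (K x) (space (K x)) \<le> ennreal 1"
    using measurable_space[OF K'] by (auto simp: space_prob_algebra prob_space.emeasure_space_1)
  ultimately show ?thesis
    using f P.finite_measure_axioms
    by (intro integral_bind[OF _ _ measurable_prob_algebraD[OF K'], where B' = 1]) auto
qed

lemma integral_kernel_measurable_bounded:
  fixes g :: "'b \<Rightarrow> real"
  assumes K: "K \<in> M \<rightarrow>\<^sub>M prob_algebra N"
    and g: "g \<in> borel_measurable N" and bdd: "bounded (g ` space N)"
  shows "(\<lambda>x. integral\<^sup>L (K x) g) \<in> borel_measurable M"
    and "bounded ((\<lambda>x. integral\<^sup>L (K x) g) ` space M)"
proof -
  show "(\<lambda>x. integral\<^sup>L (K x) g) \<in> borel_measurable M"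
    by (rule measurable_compose[OF measurable_prob_algebraD[OF K]
          integral_measurable_subprob_algebra[OF g]])
  obtain B where B: "\<And>x. x \<in> space N \<Longrightarrow> norm (g x) \<le> B"
    using bdd by (auto simp: bounded_iff)
  have "norm (integral\<^sup>L (K x) g) \<le> B" if "x \<in> space M" for x
  proof -
    have sets: "sets (K x) = sets N" and "prob_space (K x)"
      using measurable_space[OF K that] by (auto simp: space_prob_algebra)
    interpret prob_space "K x" by fact
    have sp: "space (K x) = space N"
      by (rule sets_eq_imp_space_eq[OF sets])
    have g': "g \<in> borel_measurable (K x)"
      using g measurable_cong_sets[OF sets refl] by auto
    have int: "integrable (K x) g"
      using integrable_bounded_image[OF g'] bdd by (simp add: sp)
    have "norm (integral\<^sup>L (K x) g) \<le> (\<integral>y. norm (g y) \<partial>K x)"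
      by (rule integral_norm_bound)
    also have "\<dots> \<le> (\<integral>y. B \<partial>K x)"
      using int B by (intro integral_mono) (auto simp: sp)
    finally show ?thesis
      by (simp add: prob_space)
  qed
  then show "bounded ((\<lambda>x. integral\<^sup>L (K x) g) ` space M)"
    unfolding bounded_iff by blast
qed

section \<open>The chi-square divergence through test functions\<close>

text \<open>
  For probability measures on the same sigma-algebra, the least such \<open>c\<close> is the chi-square divergence of \<open>\<mu>\<close> from \<open>\<nu>\<close>,
  written in its variational form. This form mentions no density, so it survives mixtures over an
  arbitrary measurable space, where a choice of densities that is jointly measurable in the
  mixing variable and the argument need not exist.
\<close>

definition chi2_bound :: "real \<Rightarrow> 'a measure \<Rightarrow> 'a measure \<Rightarrow> bool" where
  "chi2_bound c \<mu> \<nu> \<longleftrightarrow>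
     (\<forall>g\<in>borel_measurable \<nu>. bounded (g ` space \<nu>) \<longrightarrow>
        (integral\<^sup>L \<mu> g - integral\<^sup>L \<nu> g)\<^sup>2 \<le> c * (\<integral>x. (g x)\<^sup>2 \<partial>\<nu>))"

text \<open>
  For probability measures on the same sigma-algebra, the least such \<open>C\<close> is the second moment of \<open>d\<mu>/d\<nu>\<close> under \<open>\<nu>\<close>,
  that is, one plus the chi-square divergence. Unlike bounds on the divergence itself, bounds
  on the second moment multiply along a sequence of kernels.
\<close>

definition second_moment_bound :: "real \<Rightarrow> 'a measure \<Rightarrow> 'a measure \<Rightarrow> bool" where
  "second_moment_bound C \<mu> \<nu> \<longleftrightarrow>
     (\<forall>g\<in>borel_measurable \<nu>. bounded (g ` space \<nu>) \<longrightarrow>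
        (integral\<^sup>L \<mu> g)\<^sup>2 \<le> C * (\<integral>x. (g x)\<^sup>2 \<partial>\<nu>))"

lemma second_moment_bound_mono:
  assumes "C \<le> C'" and "second_moment_bound C \<mu> \<nu>"
  shows "second_moment_bound C' \<mu> \<nu>"
  unfolding second_moment_bound_def
proof (intro ballI impI)
  fix g :: "'a \<Rightarrow> real"
  assume "g \<in> borel_measurable \<nu>" "bounded (g ` space \<nu>)"
  then have "(integral\<^sup>L \<mu> g)\<^sup>2 \<le> C * (\<integral>x. (g x)\<^sup>2 \<partial>\<nu>)"
    using assms(2) by (simp add: second_moment_bound_def)
  also have "\<dots> \<le> C' * (\<integral>x. (g x)\<^sup>2 \<partial>\<nu>)"
    using assms(1) by (intro mult_right_mono) auto
  finally show "(integral\<^sup>L \<mu> g)\<^sup>2 \<le> C' * (\<integral>x. (g x)\<^sup>2 \<partial>\<nu>)" .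
qed

text \<open>
  With \<open>h = d\<mu>/d\<nu>\<close> the difference of the two integrals is the integral of \<open>(h - 1) g\<close> under
  \<open>\<nu>\<close>. Apply Cauchy-Schwarz: the integral of \<open>(h - 1)\<^sup>2\<close> is the second moment of \<open>h\<close> minus one,
  and the second moment of \<open>h\<close> is the exponential of the divergence.
\<close>

lemma chi2_bound_renyi_div2:
  assumes "prob_space \<mu>" "prob_space \<nu>" and sets_eq: "sets \<mu> = sets \<nu>"
    and div: "renyi_div2 \<mu> \<nu> \<le> ereal \<rho>"
  shows "chi2_bound (exp \<rho> - 1) \<mu> \<nu>"
  unfolding chi2_bound_def
proof (intro ballI impI)
  interpret \<mu>: prob_space \<mu> by fact
  interpret \<nu>: prob_space \<nu> by fact
  fix g :: "'a \<Rightarrow> real"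
  assume g [measurable]: "g \<in> borel_measurable \<nu>" and bdd: "bounded (g ` space \<nu>)"
  define I where "I = (\<integral>\<^sup>+ z. (RN_deriv \<nu> \<mu> z)\<^sup>2 \<partial>\<nu>)"
  have ac: "absolutely_continuous \<nu> \<mu>" and fin: "I < \<infinity>" and ln_le: "ln (enn2real I) \<le> \<rho>"
    using div unfolding renyi_div2_def I_def[symmetric] Let_def by (auto split: if_splits)
  \<comment> \<open>The case distinction is forced by the convention \<open>ln 0 = 0\<close>; in truth \<open>I \<ge> 1\<close>.\<close>
  have I_le: "enn2real I \<le> exp \<rho>"
  proof (cases "enn2real I > 0")
    case True
    then show ?thesis
      using ln_le by (metis exp_le_cancel_iff exp_ln)
  next
    case False
    then show ?thesis
      using exp_gt_zero[of \<rho>] by linarith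
  qed
  define h where "h z = enn2real (RN_deriv \<nu> \<mu> z)" for z
  have h [measurable]: "h \<in> borel_measurable \<nu>"
    unfolding h_def by measurable
  have AE_fin: "AE z in \<nu>. RN_deriv \<nu> \<mu> z \<noteq> \<infinity>"
    by (rule \<nu>.RN_deriv_finite[OF _ ac sets_eq]) unfold_locales
  have nn_h2: "(\<integral>\<^sup>+ z. ennreal ((h z)\<^sup>2) \<partial>\<nu>) = I"
    unfolding I_def
  proof (rule nn_integral_cong_AE)
    show "AE z in \<nu>. ennreal ((h z)\<^sup>2) = (RN_deriv \<nu> \<mu> z)\<^sup>2"
      using AE_fin
      by eventually_elim (simp add: h_def ennreal_power[symmetric] less_top)
  qed
  have int_h2: "integrable \<nu> (\<lambda>z. (h z)\<^sup>2)"
    using fin nn_h2 by (intro integrableI_nonneg) auto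
  have h2: "(\<integral>z. (h z)\<^sup>2 \<partial>\<nu>) = enn2real I"
    using nn_h2 by (subst integral_eq_nn_integral) auto
  have RN: "integral\<^sup>L \<mu> f = (\<integral>z. h z * f z \<partial>\<nu>)" "integrable \<mu> f \<longleftrightarrow> integrable \<nu> (\<lambda>z. h z * f z)"
    if "f \<in> borel_measurable \<nu>" for f :: "'a \<Rightarrow> real"
    using \<nu>.RN_deriv_integral[OF _ ac sets_eq that] \<nu>.RN_deriv_integrable[OF _ ac sets_eq that]
    by (auto simp: h_def \<mu>.sigma_finite_measure_axioms)
  have sp: "space \<mu> = space \<nu>" and g': "g \<in> borel_measurable \<mu>"
    using sets_eq sets_eq_imp_space_eq g measurable_cong_sets[OF sets_eq refl] by auto
  have int_g: "integrable \<nu> g" "integrable \<mu> g" "integrable \<nu> (\<lambda>z. (g z)\<^sup>2)"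
    using \<nu>.integrable_bounded_image[OF g bdd] \<mu>.integrable_bounded_image[OF g'] bdd
      \<nu>.integrable_bounded_image[OF _ bounded_image_power2[OF bdd]] by (auto simp: sp)
  have int_hg: "integrable \<nu> (\<lambda>z. h z * g z)"
    using RN(2)[OF g] int_g by simp
  have int_h: "integrable \<nu> h" and h_one: "(\<integral>z. h z \<partial>\<nu>) = 1"
    using RN[of "\<lambda>_. 1"] by (auto simp: \<mu>.prob_space)
  have "integral\<^sup>L \<mu> g - integral\<^sup>L \<nu> g = (\<integral>z. (h z - 1) * g z \<partial>\<nu>)"
    using int_hg int_g by (simp add: RN left_diff_distrib)
  also have "\<dots>\<^sup>2 \<le> (\<integral>z. (h z - 1)\<^sup>2 \<partial>\<nu>) * (\<integral>z. (g z)\<^sup>2 \<partial>\<nu>)"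
    using int_hg int_g int_h2 int_h
    by (intro integral_Cauchy_Schwarz) (simp_all add: power2_diff left_diff_distrib)
  also have "(\<integral>z. (h z - 1)\<^sup>2 \<partial>\<nu>) = enn2real I - 1"
    using int_h2 int_h h2 h_one by (simp add: power2_diff \<nu>.prob_space)
  also have "(enn2real I - 1) * (\<integral>z. (g z)\<^sup>2 \<partial>\<nu>) \<le> (exp \<rho> - 1) * (\<integral>z. (g z)\<^sup>2 \<partial>\<nu>)"
    using I_le by (intro mult_right_mono) auto
  finally show "(integral\<^sup>L \<mu> g - integral\<^sup>L \<nu> g)\<^sup>2 \<le> (exp \<rho> - 1) * (\<integral>z. (g z)\<^sup>2 \<partial>\<nu>)" .
qed

text \<open>
  Write the integral of \<open>g\<close> under \<open>\<mu>\<close> as \<open>m + D\<close>, where \<open>m\<close> is the mean under \<open>\<nu>\<close>. The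
  hypothesis, applied to \<open>g - m\<close>, bounds \<open>D\<^sup>2\<close> by \<open>c\<close> times the variance of \<open>g\<close>, and the mean square
  is the variance plus \<open>m\<^sup>2\<close>.
\<close>

lemma second_moment_bound_chi2_bound:
  assumes "prob_space \<mu>" "prob_space \<nu>" and sets_eq: "sets \<mu> = sets \<nu>"
    and c: "0 \<le> c" and chi: "chi2_bound c \<mu> \<nu>"
  shows "second_moment_bound (1 + c) \<mu> \<nu>"
  unfolding second_moment_bound_def
proof (intro ballI impI)
  interpret \<mu>: prob_space \<mu> by fact
  interpret \<nu>: prob_space \<nu> by fact
  fix g :: "'a \<Rightarrow> real"
  assume g [measurable]: "g \<in> borel_measurable \<nu>" and bdd: "bounded (g ` space \<nu>)"
  have sp: "space \<mu> = space \<nu>" and g': "g \<in> borel_measurable \<mu>"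
    using sets_eq sets_eq_imp_space_eq g measurable_cong_sets[OF sets_eq refl] by auto
  have int_g: "integrable \<nu> g" "integrable \<mu> g" "integrable \<nu> (\<lambda>z. (g z)\<^sup>2)"
    using \<nu>.integrable_bounded_image[OF g bdd] \<mu>.integrable_bounded_image[OF g'] bdd
      \<nu>.integrable_bounded_image[OF _ bounded_image_power2[OF bdd]] by (auto simp: sp)
  define m D S where "m = integral\<^sup>L \<nu> g" and "D = integral\<^sup>L \<mu> g - m"
    and "S = (\<integral>x. (g x)\<^sup>2 \<partial>\<nu>)"
  \<comment> \<open>Testing the centred function replaces the second moment of \<open>g\<close> by its variance.\<close>
  have "(integral\<^sup>L \<mu> (\<lambda>x. g x - m) - integral\<^sup>L \<nu> (\<lambda>x. g x - m))\<^sup>2 \<le> c * (\<integral>x. (g x - m)\<^sup>2 \<partial>\<nu>)"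
    using chi bounded_image_diff_const[OF bdd, of m] unfolding chi2_bound_def by auto
  also have "integral\<^sup>L \<mu> (\<lambda>x. g x - m) - integral\<^sup>L \<nu> (\<lambda>x. g x - m) = D"
    using int_g by (simp add: D_def m_def \<mu>.prob_space \<nu>.prob_space)
  also have "(\<integral>x. (g x - m)\<^sup>2 \<partial>\<nu>) = S - m\<^sup>2"
    using int_g by (simp add: power2_diff S_def \<nu>.prob_space)
      (simp add: m_def power2_eq_square)
  finally have D: "D\<^sup>2 \<le> c * (S - m\<^sup>2)" .
  have "(m + D)\<^sup>2 \<le> (1 + c) * S"
  proof (cases "c = 0")
    case True
    have "0 \<le> (\<integral>x. (g x - m)\<^sup>2 \<partial>\<nu>)" by simp
    with \<open>(\<integral>x. (g x - m)\<^sup>2 \<partial>\<nu>) = S - m\<^sup>2\<close> True D show ?thesis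
      by simp
  next
    case False
    with c have "c > 0" by simp
    \<comment> \<open>Cauchy-Schwarz in the plane, with weights \<open>1\<close> and \<open>c\<close>; the difference is \<open>(c m - D)\<^sup>2\<close>.\<close>
    have "c * (m + D)\<^sup>2 \<le> (1 + c) * (c * m\<^sup>2 + D\<^sup>2)"
      using zero_le_power2[of "c * m - D"] by (simp add: power2_eq_square algebra_simps)
    also have "\<dots> \<le> (1 + c) * (c * S)"
      using D c by (intro mult_left_mono) (auto simp: algebra_simps)
    finally show ?thesis
      using \<open>c > 0\<close> by (simp add: mult.left_commute)
  qed
  then show "(integral\<^sup>L \<mu> g)\<^sup>2 \<le> (1 + c) * (\<integral>x. (g x)\<^sup>2 \<partial>\<nu>)"
    by (simp add: D_def S_def)
qed

text \<open>
  The tensorisation step: integrate the conditional bound for the last step, and apply the bound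
  for the past to the conditional expectation of the test function.
\<close>

lemma second_moment_bound_bind:
  assumes \<mu>: "\<mu> \<in> space (prob_algebra M)" and \<nu>: "\<nu> \<in> space (prob_algebra M)"
    and K: "K \<in> M \<rightarrow>\<^sub>M prob_algebra N" and K': "K' \<in> M \<rightarrow>\<^sub>M prob_algebra N"
    and nonneg: "0 \<le> C"
    and base: "second_moment_bound C \<mu> \<nu>"
    and step: "\<And>z. z \<in> space M \<Longrightarrow> second_moment_bound C' (K z) (K' z)"
  shows "second_moment_bound (C * C') (\<mu> \<bind> K) (\<nu> \<bind> K')"
  unfolding second_moment_bound_def
proof (intro ballI impI)
  have simps: "sets \<mu> = sets M" "sets \<nu> = sets M" "prob_space \<nu>" "space \<nu> = space M"
    using \<mu> \<nu> by (auto simp: space_prob_algebra dest: sets_eq_imp_space_eq)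
  interpret \<nu>: prob_space \<nu> by fact
  note sets_bind = sets_bind'[OF \<nu> K']
  fix g :: "'b \<Rightarrow> real"
  assume "g \<in> borel_measurable (\<nu> \<bind> K')" and "bounded (g ` space (\<nu> \<bind> K'))"
  then have g: "g \<in> borel_measurable N" and bdd: "bounded (g ` space N)"
    using measurable_cong_sets[OF sets_bind refl] sets_eq_imp_space_eq[OF sets_bind] by auto
  have g2: "(\<lambda>z. (g z)\<^sup>2) \<in> borel_measurable N"
    using g by measurable
  note bdd2 = bounded_image_power2[OF bdd]
  define G H where "G x = integral\<^sup>L (K x) g" and "H x = (\<integral>z. (g z)\<^sup>2 \<partial>K' x)" for x
  note kernel = integral_kernel_measurable_bounded[OF K g bdd]
  note kernel' = integral_kernel_measurable_bounded[OF K' g2 bdd2]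
  have G: "G \<in> borel_measurable \<nu>" "bounded (G ` space \<nu>)"
    and H: "H \<in> borel_measurable \<nu>" "bounded (H ` space \<nu>)"
    using kernel kernel' measurable_cong_sets[OF simps(2) refl]
    by (auto simp: G_def[abs_def] H_def[abs_def] simps)
  have GH: "(G z)\<^sup>2 \<le> C' * H z" if "z \<in> space \<nu>" for z
  proof -
    have z: "z \<in> space M"
      using that simps by simp
    have K'z: "sets (K' z) = sets N" "space (K' z) = space N"
      using measurable_space[OF K' z] by (auto simp: space_prob_algebra dest: sets_eq_imp_space_eq)
    have "g \<in> borel_measurable (K' z)"
      using g measurable_cong_sets[OF K'z(1) refl] by auto
    then show ?thesis
      using step[OF z] bdd by (simp add: second_moment_bound_def G_def H_def K'z)
  qed
  have "(integral\<^sup>L \<mu> G)\<^sup>2 \<le> C * (\<integral>z. (G z)\<^sup>2 \<partial>\<nu>)"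
    using base G by (simp add: second_moment_bound_def)
  also have "\<dots> \<le> C * (\<integral>z. C' * H z \<partial>\<nu>)"
  proof (intro mult_left_mono integral_mono GH nonneg)
    show "integrable \<nu> (\<lambda>z. (G z)\<^sup>2)"
      using G bounded_image_power2[OF G(2)] by (intro \<nu>.integrable_bounded_image) auto
    show "integrable \<nu> (\<lambda>z. C' * H z)"
      using \<nu>.integrable_bounded_image[OF H] by simp
  qed
  also have "\<dots> = C * C' * integral\<^sup>L \<nu> H"
    by simp
  finally show "(integral\<^sup>L (\<mu> \<bind> K) g)\<^sup>2 \<le> C * C' * (\<integral>x. (g x)\<^sup>2 \<partial>(\<nu> \<bind> K'))"
    using integral_bind_prob_algebra[OF \<mu> K g bdd] integral_bind_prob_algebra[OF \<nu> K' g2 bdd2]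
    by (simp add: G_def[abs_def] H_def[abs_def])
qed

lemma second_moment_bound_distr:
  assumes sets_eq: "sets \<mu> = sets \<nu>" and h: "h \<in> \<nu> \<rightarrow>\<^sub>M N"
    and bound: "second_moment_bound C \<mu> \<nu>"
  shows "second_moment_bound C (distr \<mu> N h) (distr \<nu> N h)"
  unfolding second_moment_bound_def
proof (intro ballI impI)
  fix g :: "'b \<Rightarrow> real"
  assume "g \<in> borel_measurable (distr \<nu> N h)" and "bounded (g ` space (distr \<nu> N h))"
  then have g: "g \<in> borel_measurable N" and bdd: "bounded (g ` space N)"
    by auto
  have h': "h \<in> \<mu> \<rightarrow>\<^sub>M N"
    using h measurable_cong_sets[OF sets_eq refl] by auto
  have g2: "(\<lambda>z. (g z)\<^sup>2) \<in> borel_measurable N"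
    using g by measurable
  have "bounded ((\<lambda>z. g (h z)) ` space \<nu>)"
    by (rule bounded_subset[OF bdd]) (use measurable_space[OF h] in auto)
  then show "(integral\<^sup>L (distr \<mu> N h) g)\<^sup>2 \<le> C * (\<integral>x. (g x)\<^sup>2 \<partial>distr \<nu> N h)"
    using bound measurable_compose[OF h g]
    by (simp add: second_moment_bound_def integral_distr[OF h g2] integral_distr[OF h' g])
qed

section \<open>Total variation and mixtures\<close>

lemma abs_measure_diff_le_tv_dist:
  assumes "prob_space P" "prob_space P'" and A: "A \<in> sets P"
  shows "\<bar>measure P A - measure P' A\<bar> \<le> tv_dist P P'"
  unfolding tv_dist_def
proof (rule cSUP_upper[OF A])
  interpret P: prob_space P by fact
  interpret P': prob_space P' by fact
  have "\<bar>measure P B - measure P' B\<bar> \<le> 1" for B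
    using P.prob_le_1[of B] P'.prob_le_1[of B] measure_nonneg[of P B] measure_nonneg[of P' B]
    by linarith
  then show "bdd_above ((\<lambda>A. \<bar>measure P A - measure P' A\<bar>) ` sets P)"
    by (rule bdd_aboveI2)
qed

text \<open>
  The layer-cake formula, by Fubini for the region under the graph of \<open>u\<close>. It reduces
  statements on integrals to statements on probabilities of events.
\<close>

lemma nn_integral_eq_integral_tail:
  fixes u :: "'a \<Rightarrow> real"
  assumes "sigma_finite_measure M" and u [measurable]: "u \<in> borel_measurable M"
    and u01: "\<And>x. x \<in> space M \<Longrightarrow> 0 \<le> u x \<and> u x \<le> 1"
  shows "(\<integral>\<^sup>+x. ennreal (u x) \<partial>M) =
    (\<integral>\<^sup>+t. emeasure M {x \<in> space M. t < u x} * indicator {0..<1} t \<partial>lborel)"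
proof -
  interpret sigma_finite_measure M by fact
  interpret pair_sigma_finite M lborel ..
  have "(\<integral>\<^sup>+x. ennreal (u x) \<partial>M) =
      (\<integral>\<^sup>+x. \<integral>\<^sup>+t. (if 0 \<le> t \<and> t < u x then 1 else 0) \<partial>lborel \<partial>M)"
  proof (rule nn_integral_cong)
    fix x assume "x \<in> space M"
    have "(\<integral>\<^sup>+t. (if 0 \<le> t \<and> t < u x then 1 else 0) \<partial>lborel) = (\<integral>\<^sup>+t. indicator {0..<u x} t \<partial>lborel)"
      by (intro nn_integral_cong) (auto simp: indicator_def)
    also have "\<dots> = ennreal (u x)"
      using u01[OF \<open>x \<in> space M\<close>] by simp
    finally show "ennreal (u x) = (\<integral>\<^sup>+t. (if 0 \<le> t \<and> t < u x then 1 else 0) \<partial>lborel)" ..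
  qed
  also have "\<dots> = (\<integral>\<^sup>+t. \<integral>\<^sup>+x. (if 0 \<le> t \<and> t < u x then 1 else 0) \<partial>M \<partial>lborel)"
    by (rule Fubini'[symmetric]) measurable
  also have "\<dots> = (\<integral>\<^sup>+t. emeasure M {x \<in> space M. t < u x} * indicator {0..<1} t \<partial>lborel)"
  proof (rule nn_integral_cong)
    fix t :: real
    have "(\<integral>\<^sup>+x. (if 0 \<le> t \<and> t < u x then 1 else 0) \<partial>M) =
        (\<integral>\<^sup>+x. indicator {0..<1} t * indicator {x \<in> space M. t < u x} x \<partial>M)"
      using u01 by (intro nn_integral_cong) (force simp: indicator_def)
    also have "\<dots> = indicator {0..<1} t * emeasure M {x \<in> space M. t < u x}"
      by (subst nn_integral_cmult_indicator) auto
    finally show "(\<integral>\<^sup>+x. (if 0 \<le> t \<and> t < u x then 1 else 0) \<partial>M) =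
        emeasure M {x \<in> space M. t < u x} * indicator {0..<1} t"
      by (simp add: mult.commute)
  qed
  finally show ?thesis .
qed

lemma integral_le_integral_add_tv:
  fixes u :: "'a \<Rightarrow> real"
  assumes "prob_space P" "prob_space P'" and sets_eq: "sets P = sets P'"
    and tv: "\<And>A. A \<in> sets P \<Longrightarrow> measure P A \<le> measure P' A + \<delta>"
    and u [measurable]: "u \<in> borel_measurable P"
    and u01: "\<And>x. x \<in> space P \<Longrightarrow> 0 \<le> u x \<and> u x \<le> 1"
  shows "integral\<^sup>L P u \<le> integral\<^sup>L P' u + \<delta>"
proof -
  interpret P: prob_space P by fact
  interpret P': prob_space P' by fact
  have sp: "space P = space P'"
    using sets_eq sets_eq_imp_space_eq by auto
  have u' [measurable]: "u \<in> borel_measurable P'"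
    using u by (simp add: measurable_cong_sets[OF sets_eq refl])
  have bdd: "bounded (u ` space P)"
    unfolding bounded_iff using u01 by (intro exI[of _ 1]) auto
  have int: "integrable P u" "integrable P' u"
    using P.integrable_bounded_image[OF u bdd] P'.integrable_bounded_image[OF u'] bdd
    by (auto simp: sp)
  have "\<delta> \<ge> 0"
    using tv[of "{}"] by simp
  have "(\<integral>\<^sup>+x. ennreal (u x) \<partial>P) \<le>
      (\<integral>\<^sup>+t. emeasure P' {x \<in> space P'. t < u x} * indicator {0..<1} t
        + ennreal \<delta> * indicator {0..<1::real} t \<partial>lborel)"
    unfolding nn_integral_eq_integral_tail[OF P.sigma_finite_measure_axioms u u01, simplified]
  proof (rule nn_integral_mono)
    fix t :: real
    have "emeasure P {x \<in> space P. t < u x} \<le> emeasure P' {x \<in> space P. t < u x} + ennreal \<delta>"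
      using tv[of "{x \<in> space P. t < u x}"] \<open>\<delta> \<ge> 0\<close>
      by (simp add: P.emeasure_eq_measure P'.emeasure_eq_measure flip: ennreal_plus)
    then show "emeasure P {x \<in> space P. t < u x} * indicator {0..<1} t \<le>
        emeasure P' {x \<in> space P'. t < u x} * indicator {0..<1} t
        + ennreal \<delta> * indicator {0..<1::real} t"
      by (auto simp: indicator_def sp)
  qed
  also have "\<dots> = (\<integral>\<^sup>+x. ennreal (u x) \<partial>P') + ennreal \<delta>"
    using nn_integral_eq_integral_tail[OF P'.sigma_finite_measure_axioms u'] u01
    by (subst nn_integral_add) (auto simp: sp nn_integral_cmult_indicator)
  also have "(\<integral>\<^sup>+x. ennreal (u x) \<partial>P') = ennreal (integral\<^sup>L P' u)"
    using int u01 by (intro nn_integral_eq_integral) (auto simp: sp)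
  also have "(\<integral>\<^sup>+x. ennreal (u x) \<partial>P) = ennreal (integral\<^sup>L P u)"
    using int u01 by (intro nn_integral_eq_integral) auto
  finally have "ennreal (integral\<^sup>L P u) \<le> ennreal (integral\<^sup>L P' u) + ennreal \<delta>" .
  then have "ennreal (integral\<^sup>L P u) \<le> ennreal (integral\<^sup>L P' u + \<delta>)"
    using u01 \<open>\<delta> \<ge> 0\<close> by (simp add: sp integral_nonneg_AE flip: ennreal_plus)
  then show ?thesis
    using u01 \<open>\<delta> \<ge> 0\<close> by (subst (asm) ennreal_le_iff) (auto simp: sp intro!: add_nonneg_nonneg integral_nonneg_AE)
qed

text \<open>
  Rescaling reduces this to functions into the unit interval; the factor 2 comes from the length
  \<open>2 s\<close> of the interval in which \<open>G\<close> takes its values.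
\<close>

lemma abs_integral_diff_le_tv:
  fixes G :: "'a \<Rightarrow> real"
  assumes "prob_space P" "prob_space P'" and sets_eq: "sets P = sets P'"
    and tv: "\<And>A. A \<in> sets P \<Longrightarrow> \<bar>measure P A - measure P' A\<bar> \<le> \<delta>"
    and G [measurable]: "G \<in> borel_measurable P"
    and osc: "\<And>x. x \<in> space P \<Longrightarrow> \<bar>G x - a\<bar> \<le> s"
  shows "\<bar>integral\<^sup>L P G - integral\<^sup>L P' G\<bar> \<le> 2 * \<delta> * s"
proof -
  interpret P: prob_space P by fact
  interpret P': prob_space P' by fact
  have sp: "space P = space P'"
    using sets_eq sets_eq_imp_space_eq by auto
  have M: "borel_measurable P = (borel_measurable P' :: ('a \<Rightarrow> real) set)"
    by (rule measurable_cong_sets[OF sets_eq refl])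
  have G' [measurable]: "G \<in> borel_measurable P'"
    using G by (simp add: M)
  obtain x0 where "x0 \<in> space P"
    using P.not_empty by auto
  have "s \<ge> 0"
    using osc[OF \<open>x0 \<in> space P\<close>] by linarith
  have "bounded (G ` space P)"
    unfolding bounded_iff
  proof (intro exI[of _ "\<bar>a\<bar> + s"] ballI)
    fix y assume "y \<in> G ` space P"
    then show "norm y \<le> \<bar>a\<bar> + s"
      using osc by force
  qed
  then have int: "integrable P G" "integrable P' G"
    using P.integrable_bounded_image[OF G] P'.integrable_bounded_image[OF G'] by (auto simp: sp)
  show ?thesis
  proof (cases "s = 0")
    case True
    then have "G x = a" if "x \<in> space P" for x
      using osc[OF that] by simp
    then have "integral\<^sup>L P G = integral\<^sup>L P (\<lambda>_. a)" "integral\<^sup>L P' G = integral\<^sup>L P' (\<lambda>_. a)"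
      by (intro Bochner_Integration.integral_cong refl; simp add: sp)+
    then show ?thesis
      using True by (simp add: P.prob_space P'.prob_space)
  next
    case False
    with \<open>s \<ge> 0\<close> have "s > 0" by simp
    \<comment> \<open>The affine map that sends \<open>{a - s..a + s}\<close>, where \<open>G\<close> takes its values, onto the unit interval.\<close>
    define u where "u x = (G x - a + s) / (2 * s)" for x
    have u [measurable]: "u \<in> borel_measurable P" "u \<in> borel_measurable P'"
      unfolding u_def by measurable
    have u01: "0 \<le> u x \<and> u x \<le> 1" if "x \<in> space P" for x
      using osc[OF that] \<open>s > 0\<close> by (auto simp: u_def field_simps abs_le_iff)
    have u_int: "integral\<^sup>L P u = (integral\<^sup>L P G - a + s) / (2 * s)"
      "integral\<^sup>L P' u = (integral\<^sup>L P' G - a + s) / (2 * s)"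
      unfolding u_def using int by (simp_all add: P.prob_space P'.prob_space)
    have "integral\<^sup>L P u \<le> integral\<^sup>L P' u + \<delta>"
      using tv u01
      by (intro integral_le_integral_add_tv[OF assms(1,2) sets_eq]) (auto simp: abs_le_iff algebra_simps)
    moreover have "integral\<^sup>L P' u \<le> integral\<^sup>L P u + \<delta>"
      using tv u01 sets_eq
      by (intro integral_le_integral_add_tv[OF assms(2,1) sets_eq[symmetric]])
        (auto simp: abs_le_iff algebra_simps sp)
    ultimately have "\<bar>integral\<^sup>L P u - integral\<^sup>L P' u\<bar> \<le> \<delta>"
      by linarith
    moreover have "integral\<^sup>L P u - integral\<^sup>L P' u = (integral\<^sup>L P G - integral\<^sup>L P' G) / (2 * s)"
      by (simp add: u_int diff_divide_distrib add_divide_distrib)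
    ultimately show ?thesis
      using \<open>s > 0\<close> by (simp add: abs_divide pos_divide_le_eq mult.commute mult.left_commute)
  qed
qed

text \<open>
  Mutual closeness of the components and closeness of the mixing laws multiply: \<open>c\<close> is scaled
  by the square of the total variation distance. The integral of \<open>g\<close> under a mixture is the integral of
  \<open>G x = \<integral> g dK\<^sub>x\<close> under the input law, and \<open>G\<close> deviates from any of its values \<open>G x'\<close> by at most
  \<open>sqrt (c \<cdot> \<integral> g\<^sup>2 dK\<^sub>x\<^sub>')\<close>, so total variation bounds the difference of the two integrals.
\<close>

lemma chi2_bound_mixture:
  assumes P: "P \<in> space (prob_algebra M)" and P': "P' \<in> space (prob_algebra M)"
    and K: "K \<in> M \<rightarrow>\<^sub>M prob_algebra N"
    and tv: "\<And>A. A \<in> sets M \<Longrightarrow> \<bar>measure P A - measure P' A\<bar> \<le> \<delta>"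
    and c: "0 \<le> c"
    and chi: "\<And>x x'. x \<in> space M \<Longrightarrow> x' \<in> space M \<Longrightarrow> chi2_bound c (K x) (K x')"
  shows "chi2_bound (4 * \<delta>\<^sup>2 * c) (P \<bind> K) (P' \<bind> K)"
  unfolding chi2_bound_def
proof (intro ballI impI)
  have P_simps: "sets P = sets M" "prob_space P" "space P = space M"
    "sets P' = sets M" "prob_space P'" "space P' = space M"
    using P P' by (auto simp: space_prob_algebra dest: sets_eq_imp_space_eq)
  interpret P: prob_space P by fact
  interpret P': prob_space P' by fact
  note sets_bind = sets_bind'[OF P' K]
  fix g :: "'b \<Rightarrow> real"
  assume "g \<in> borel_measurable (P' \<bind> K)" and "bounded (g ` space (P' \<bind> K))"
  then have g: "g \<in> borel_measurable N" and bdd: "bounded (g ` space N)"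
    using measurable_cong_sets[OF sets_bind refl] sets_eq_imp_space_eq[OF sets_bind] by auto
  have g2: "(\<lambda>z. (g z)\<^sup>2) \<in> borel_measurable N"
    using g by measurable
  note bdd2 = bounded_image_power2[OF bdd]
  define G H where "G x = integral\<^sup>L (K x) g" and "H x = (\<integral>z. (g z)\<^sup>2 \<partial>K x)" for x
  note kernel_int = integral_kernel_measurable_bounded[OF K]
  have G: "G \<in> borel_measurable P" and H: "H \<in> borel_measurable P'"
    using kernel_int(1)[OF g bdd] kernel_int(1)[OF g2 bdd2]
      measurable_cong_sets[OF P_simps(1) refl] measurable_cong_sets[OF P_simps(4) refl]
    by (auto simp: G_def[abs_def] H_def[abs_def])
  have int_H: "integrable P' H"
    using P'.integrable_bounded_image[OF H] kernel_int(2)[OF g2 bdd2] by (simp add: H_def P_simps)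
  define D where "D = integral\<^sup>L P G - integral\<^sup>L P' G"
  have D_le: "D\<^sup>2 \<le> 4 * \<delta>\<^sup>2 * c * H x'" if x': "x' \<in> space M" for x'
  proof -
    have Kx': "sets (K x') = sets N" "space (K x') = space N"
      using measurable_space[OF K x'] by (auto simp: space_prob_algebra dest: sets_eq_imp_space_eq)
    have "H x' \<ge> 0"
      by (simp add: H_def)
    \<comment> \<open>Closeness of the components makes \<open>G\<close> vary little around its value at \<open>x'\<close>.\<close>
    have "\<bar>G x - G x'\<bar> \<le> sqrt (c * H x')" if "x \<in> space P" for x
    proof (rule real_le_rsqrt)
      have "g \<in> borel_measurable (K x')"
        using g measurable_cong_sets[OF Kx'(1) refl] by auto
      then show "\<bar>G x - G x'\<bar>\<^sup>2 \<le> c * H x'"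
        using chi[OF _ x', of x] that bdd by (simp add: chi2_bound_def G_def H_def P_simps Kx')
    qed
    then have "\<bar>D\<bar> \<le> 2 * \<delta> * sqrt (c * H x')"
      unfolding D_def using tv G
      by (intro abs_integral_diff_le_tv[OF P_simps(2,5)]) (auto simp: P_simps)
    then have "\<bar>D\<bar>\<^sup>2 \<le> (2 * \<delta> * sqrt (c * H x'))\<^sup>2"
      by (intro power_mono) auto
    then show ?thesis
      using c \<open>H x' \<ge> 0\<close> by (simp add: power_mult_distrib)
  qed
  \<comment> \<open>The bound holds for every \<open>x'\<close>, so it may be averaged over \<open>P'\<close>, which turns \<open>H\<close> into the second moment
    of \<open>g\<close> under the mixture.\<close>
  have "D\<^sup>2 = (\<integral>x'. D\<^sup>2 \<partial>P')"
    by (simp add: P'.prob_space)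
  also have "\<dots> \<le> (\<integral>x'. 4 * \<delta>\<^sup>2 * c * H x' \<partial>P')"
    using int_H D_le by (intro integral_mono) (auto simp: P_simps)
  also have "\<dots> = 4 * \<delta>\<^sup>2 * c * integral\<^sup>L P' H"
    by simp
  finally have "D\<^sup>2 \<le> 4 * \<delta>\<^sup>2 * c * integral\<^sup>L P' H" .
  then show "(integral\<^sup>L (P \<bind> K) g - integral\<^sup>L (P' \<bind> K) g)\<^sup>2
      \<le> 4 * \<delta>\<^sup>2 * c * (\<integral>x. (g x)\<^sup>2 \<partial>(P' \<bind> K))"
    using integral_bind_prob_algebra[OF P K g bdd] integral_bind_prob_algebra[OF P' K g bdd]
      integral_bind_prob_algebra[OF P' K g2 bdd2]
    by (simp add: D_def G_def[abs_def] H_def[abs_def])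
qed

section \<open>The observations as a process\<close>

lemma seq_channels_cong:
  assumes "sets P = sets MX"
  shows "seq_channels P MZ n = seq_channels MX MZ n"
  unfolding seq_channels_def
  by (simp add: measurable_cong_sets[OF sets_pair_measure_cong[OF assms refl] refl])

lemma seq_channelsD:
  assumes "Q \<in> seq_channels MX MZ n" "i < n"
  shows "(\<lambda>(x, z). Q i x z) \<in> MX \<Otimes>\<^sub>M Pi\<^sub>M {..<i} (\<lambda>_. MZ) \<rightarrow>\<^sub>M prob_algebra MZ"
  using assms by (simp add: seq_channels_def)

lemma channel_section_measurable:
  assumes Q: "Q \<in> seq_channels MX MZ n" and i: "i < n"
    and z: "z \<in> space (Pi\<^sub>M {..<i} (\<lambda>_. MZ))"
  shows "(\<lambda>x. Q i x z) \<in> MX \<rightarrow>\<^sub>M prob_algebra MZ"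
  using measurable_compose[OF measurable_Pair2'[OF z] seq_channelsD[OF Q i]] by simp

lemma measurable_append_obs:
  "(\<lambda>(z, w). z(i := w)) \<in>
     Pi\<^sub>M {..<i} (\<lambda>_. M) \<Otimes>\<^sub>M M \<rightarrow>\<^sub>M Pi\<^sub>M {..<Suc i} (\<lambda>_. M)"
  using measurable_add_dim[of i "{..<i}" "\<lambda>_. M"] by (simp add: lessThan_Suc)

lemma append_obs_section_measurable:
  assumes z: "z \<in> space (Pi\<^sub>M {..<i} (\<lambda>_. M))"
  shows "(\<lambda>w. z(i := w)) \<in> M \<rightarrow>\<^sub>M Pi\<^sub>M {..<Suc i} (\<lambda>_. M)"
  using measurable_compose[OF measurable_Pair1'[OF z] measurable_append_obs] by simp

lemma cond_obs_law_cong: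
  assumes "\<And>j. j < i \<Longrightarrow> x j = y j"
  shows "cond_obs_law MZ Q x i = cond_obs_law MZ Q y i"
  using assms by (induction i) auto

lemma cond_obs_law_measurable:
  assumes Q: "Q \<in> seq_channels MX MZ n" and "i \<le> n" "i \<le> m"
  shows "(\<lambda>x. cond_obs_law MZ Q x i) \<in>
    Pi\<^sub>M {..<m} (\<lambda>_. MX) \<rightarrow>\<^sub>M prob_algebra (Pi\<^sub>M {..<i} (\<lambda>_. MZ))"
  using assms(2,3)
proof (induction i)
  case 0
  show ?case
    by (auto intro!: measurable_const simp: space_prob_algebra prob_space_return space_PiM)
next
  case (Suc i)
  let ?X = "Pi\<^sub>M {..<m} (\<lambda>_. MX)" and ?Z = "\<lambda>i. Pi\<^sub>M {..<i} (\<lambda>_. MZ)"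
  have proj: "(\<lambda>(x, z). (x i, z)) \<in> ?X \<Otimes>\<^sub>M ?Z i \<rightarrow>\<^sub>M MX \<Otimes>\<^sub>M ?Z i"
    using Suc.prems unfolding case_prod_beta
    by (intro measurable_Pair measurable_snd
        measurable_compose[OF measurable_fst measurable_component_singleton]) auto
  have kernel: "(\<lambda>(x, z). Q i (x i) z) \<in> ?X \<Otimes>\<^sub>M ?Z i \<rightarrow>\<^sub>M prob_algebra MZ"
    using measurable_compose[OF proj seq_channelsD[OF Q, of i]] Suc.prems
    by (simp add: case_prod_beta)
  have "(\<lambda>(p, w). (snd p, w)) \<in> (?X \<Otimes>\<^sub>M ?Z i) \<Otimes>\<^sub>M MZ \<rightarrow>\<^sub>M ?Z i \<Otimes>\<^sub>M MZ"
    by measurable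
  from measurable_compose[OF this measurable_append_obs]
  have append: "(\<lambda>(p, w). (snd p)(i := w)) \<in> (?X \<Otimes>\<^sub>M ?Z i) \<Otimes>\<^sub>M MZ \<rightarrow>\<^sub>M ?Z (Suc i)"
    by (simp add: case_prod_beta)
  have step: "(\<lambda>(x, z). distr (Q i (x i) z) (?Z (Suc i)) (\<lambda>w. z(i := w))) \<in>
      ?X \<Otimes>\<^sub>M ?Z i \<rightarrow>\<^sub>M prob_algebra (?Z (Suc i))"
    using measurable_distr_prob_space2[OF kernel append] by (simp add: case_prod_beta)
  show ?case
    unfolding cond_obs_law.simps
    by (rule measurable_bind_prob_space2[OF Suc.IH step]) (use Suc.prems in auto)
qed

lemma PiM_in_prob_algebra:
  assumes "P \<in> space (prob_algebra M)"
  shows "Pi\<^sub>M I (\<lambda>_. P) \<in> space (prob_algebra (Pi\<^sub>M I (\<lambda>_. M)))"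
  using assms by (auto simp: space_prob_algebra intro!: prob_space_PiM sets_PiM_cong)

lemma obs_law_in_prob_algebra:
  assumes Q: "Q \<in> seq_channels MX MZ n" and P: "P \<in> space (prob_algebra MX)" and i: "i \<le> n"
  shows "obs_law MZ i Q P \<in> space (prob_algebra (Pi\<^sub>M {..<i} (\<lambda>_. MZ)))"
  using prob_space_bind'[OF PiM_in_prob_algebra[OF P] cond_obs_law_measurable[OF Q i order_refl]]
    sets_bind'[OF PiM_in_prob_algebra[OF P] cond_obs_law_measurable[OF Q i order_refl]]
  by (simp add: obs_law_def space_prob_algebra)

text \<open>
  The kernel by which the private sample grows from \<open>i\<close> to \<open>i + 1\<close> observations when the datum of
  round \<open>i\<close> has law \<open>P\<close> and is not observed.
\<close>

definition marginal_step ::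
    "'z measure \<Rightarrow> ('x, 'z) channel \<Rightarrow> 'x measure \<Rightarrow> nat \<Rightarrow> (nat \<Rightarrow> 'z) \<Rightarrow> (nat \<Rightarrow> 'z) measure" where
  "marginal_step MZ Q P i z =
     distr (P \<bind> (\<lambda>x. Q i x z)) (Pi\<^sub>M {..<Suc i} (\<lambda>_. MZ)) (\<lambda>w. z(i := w))"

lemma marginal_step_measurable:
  assumes Q: "Q \<in> seq_channels MX MZ n" and P: "P \<in> space (prob_algebra MX)" and i: "i < n"
  shows "marginal_step MZ Q P i \<in>
    Pi\<^sub>M {..<i} (\<lambda>_. MZ) \<rightarrow>\<^sub>M prob_algebra (Pi\<^sub>M {..<Suc i} (\<lambda>_. MZ))"
proof -
  let ?Z = "Pi\<^sub>M {..<i} (\<lambda>_. MZ)"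
  have "(\<lambda>(z, x). Q i x z) \<in> ?Z \<Otimes>\<^sub>M MX \<rightarrow>\<^sub>M prob_algebra MZ"
    using measurable_compose[OF measurable_pair_swap' seq_channelsD[OF Q i]]
    by (simp add: case_prod_beta)
  then have "(\<lambda>z. P \<bind> (\<lambda>x. Q i x z)) \<in> ?Z \<rightarrow>\<^sub>M prob_algebra MZ"
    by (rule measurable_bind_prob_space2[OF measurable_const[OF P]])
  then show ?thesis
    unfolding marginal_step_def[abs_def]
    by (rule measurable_distr_prob_space2) (rule measurable_append_obs)
qed

text \<open>
  By definition, \<open>obs_law\<close> draws all data before the first round. As they are independent, the datum
  of round \<open>i\<close> can instead be drawn when it is needed: it is independent of the past
  observations, so the observations form a process with the marginal kernels as transitions.
\<close>

lemma obs_law_Suc: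
  assumes Q: "Q \<in> seq_channels MX MZ n" and P: "P \<in> space (prob_algebra MX)" and i: "i < n"
  shows "obs_law MZ (Suc i) Q P = obs_law MZ i Q P \<bind> marginal_step MZ Q P i"
proof (rule measure_eqI)
  let ?X = "\<lambda>i. Pi\<^sub>M {..<i} (\<lambda>_. P)" and ?Z = "\<lambda>i. Pi\<^sub>M {..<i} (\<lambda>_. MZ)"
  have sets_P: "sets P = sets MX" and prob_P: "prob_space P"
    using P by (auto simp: space_prob_algebra)
  have QP: "Q \<in> seq_channels P MZ n"
    using Q by (simp add: seq_channels_cong[OF sets_P])
  interpret P: prob_space P by fact
  interpret X: product_sigma_finite "\<lambda>_::nat. P" ..
  have obs_i: "obs_law MZ i Q P \<in> space (prob_algebra (?Z i))"
    and sets_Suc: "sets (obs_law MZ (Suc i) Q P) = sets (?Z (Suc i))"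
    using obs_law_in_prob_algebra[OF Q P] i by (auto simp: space_prob_algebra)
  show "sets (obs_law MZ (Suc i) Q P) = sets (obs_law MZ i Q P \<bind> marginal_step MZ Q P i)"
    using sets_bind'[OF obs_i marginal_step_measurable[OF Q P i]] sets_Suc by simp
  fix A assume "A \<in> sets (obs_law MZ (Suc i) Q P)"
  then have A: "A \<in> sets (?Z (Suc i))"
    using sets_Suc by simp
  define f :: "(nat \<Rightarrow> 'b) \<Rightarrow> ennreal" where "f = indicator A"
  have f: "f \<in> borel_measurable (?Z (Suc i))"
    using A by (simp add: f_def)
  define h where "h y z = (\<integral>\<^sup>+w. f (z(i := w)) \<partial>Q i y z)" for y z
  have h: "(\<lambda>(y, z). h y z) \<in> borel_measurable (P \<Otimes>\<^sub>M ?Z i)"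
  proof -
    have "(\<lambda>(p, w). (snd p, w)) \<in> (P \<Otimes>\<^sub>M ?Z i) \<Otimes>\<^sub>M MZ \<rightarrow>\<^sub>M ?Z i \<Otimes>\<^sub>M MZ"
      by measurable
    from measurable_compose[OF measurable_compose[OF this measurable_append_obs] f]
    have "(\<lambda>(p, w). f ((snd p)(i := w))) \<in> borel_measurable ((P \<Otimes>\<^sub>M ?Z i) \<Otimes>\<^sub>M MZ)"
      by (simp add: case_prod_beta)
    from nn_integral_measurable_subprob_algebra2[OF this
        measurable_prob_algebraD[OF seq_channelsD[OF QP i]]]
    show ?thesis
      by (simp add: h_def case_prod_beta)
  qed
  have cond_Suc: "(\<lambda>x. cond_obs_law MZ Q x (Suc i)) \<in> ?X (Suc i) \<rightarrow>\<^sub>M prob_algebra (?Z (Suc i))"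
    and cond_i: "(\<lambda>x. cond_obs_law MZ Q x i) \<in> ?X i \<rightarrow>\<^sub>M prob_algebra (?Z i)"
    using i by (auto intro!: cond_obs_law_measurable[OF QP] simp del: cond_obs_law.simps)
  define F where "F x = (\<integral>\<^sup>+z. f z \<partial>cond_obs_law MZ Q x (Suc i))" for x
  have F: "F \<in> borel_measurable (?X (Suc i))"
    unfolding F_def[abs_def]
    by (rule measurable_compose[OF measurable_prob_algebraD[OF cond_Suc]
          nn_integral_measurable_subprob_algebra[OF f]])
  have F_upd: "F (x(i := y)) = (\<integral>\<^sup>+z. h y z \<partial>cond_obs_law MZ Q x i)"
    if x: "x \<in> space (?X i)" and y: "y \<in> space P" for x y
  proof -
    let ?K = "\<lambda>z. distr (Q i y z) (?Z (Suc i)) (\<lambda>w. z(i := w))"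
    have sets_cond: "sets (cond_obs_law MZ Q x i) = sets (?Z i)"
      using measurable_space[OF cond_i x] by (auto simp: space_prob_algebra)
    have sec: "Q i y \<in> ?Z i \<rightarrow>\<^sub>M prob_algebra MZ"
      using measurable_compose[OF measurable_Pair1'[OF y] seq_channelsD[OF QP i]] by simp
    have K: "?K \<in> cond_obs_law MZ Q x i \<rightarrow>\<^sub>M subprob_algebra (?Z (Suc i))"
      unfolding measurable_cong_sets[OF sets_cond refl]
      by (intro measurable_prob_algebraD measurable_distr_prob_space2[OF sec measurable_append_obs])
    have "F (x(i := y)) = (\<integral>\<^sup>+z. f z \<partial>(cond_obs_law MZ Q x i \<bind> ?K))"
      by (simp add: F_def cond_obs_law_cong[of i "x(i := y)" x])
    also have "\<dots> = (\<integral>\<^sup>+z. \<integral>\<^sup>+w. f w \<partial>?K z \<partial>cond_obs_law MZ Q x i)"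
      by (rule nn_integral_bind[OF f K])
    also have "\<dots> = (\<integral>\<^sup>+z. h y z \<partial>cond_obs_law MZ Q x i)"
    proof (rule nn_integral_cong)
      fix z assume "z \<in> space (cond_obs_law MZ Q x i)"
      then have z: "z \<in> space (?Z i)"
        using sets_eq_imp_space_eq[OF sets_cond] by simp
      have "sets (Q i y z) = sets MZ"
        using measurable_space[OF sec z] by (auto simp: space_prob_algebra)
      then have "(\<lambda>w. z(i := w)) \<in> Q i y z \<rightarrow>\<^sub>M ?Z (Suc i)"
        using append_obs_section_measurable[OF z] measurable_cong_sets by blast
      then show "(\<integral>\<^sup>+w. f w \<partial>?K z) = h y z"
        using f by (simp add: nn_integral_distr h_def)
    qed
    finally show ?thesis .
  qed
  have marg: "(\<integral>\<^sup>+w. f w \<partial>marginal_step MZ Q P i z) = (\<integral>\<^sup>+y. h y z \<partial>P)"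
    if z: "z \<in> space (?Z i)" for z
  proof -
    have sec: "(\<lambda>x. Q i x z) \<in> P \<rightarrow>\<^sub>M prob_algebra MZ"
      by (rule channel_section_measurable[OF QP i z])
    have "P \<in> space (prob_algebra P)"
      by (simp add: space_prob_algebra prob_P)
    from sets_bind'[OF this sec]
    have app: "(\<lambda>w. z(i := w)) \<in> (P \<bind> (\<lambda>x. Q i x z)) \<rightarrow>\<^sub>M ?Z (Suc i)"
      using append_obs_section_measurable[OF z] measurable_cong_sets by blast
    have "(\<integral>\<^sup>+w. f w \<partial>marginal_step MZ Q P i z) = (\<integral>\<^sup>+w. f (z(i := w)) \<partial>(P \<bind> (\<lambda>x. Q i x z)))"
      unfolding marginal_step_def by (simp add: nn_integral_distr[OF app] f)
    also have "\<dots> = (\<integral>\<^sup>+y. h y z \<partial>P)"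
      unfolding h_def
      by (rule nn_integral_bind[OF measurable_compose[OF append_obs_section_measurable[OF z] f]
            measurable_prob_algebraD[OF sec]])
    finally show ?thesis .
  qed
  have "emeasure (obs_law MZ (Suc i) Q P) A = (\<integral>\<^sup>+z. f z \<partial>obs_law MZ (Suc i) Q P)"
    using A sets_Suc by (simp add: f_def)
  also have "\<dots> = integral\<^sup>N (?X (Suc i)) F"
    unfolding obs_law_def F_def[abs_def]
    by (rule nn_integral_bind[OF f measurable_prob_algebraD[OF cond_Suc]])
  \<comment> \<open>Split off the datum of round \<open>i\<close>, which the earlier observations do not depend on \<dots>\<close>
  also have "\<dots> = (\<integral>\<^sup>+x. \<integral>\<^sup>+y. F (x(i := y)) \<partial>P \<partial>?X i)"
    using X.product_nn_integral_insert[of "{..<i}" i F] F by (simp add: lessThan_Suc)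
  \<comment> \<open>\<dots> and integrate it out before the earlier observations.\<close>
  also have "\<dots> = (\<integral>\<^sup>+x. \<integral>\<^sup>+z. \<integral>\<^sup>+y. h y z \<partial>P \<partial>cond_obs_law MZ Q x i \<partial>?X i)"
  proof (rule nn_integral_cong)
    fix x assume x: "x \<in> space (?X i)"
    have sets_cond: "sets (cond_obs_law MZ Q x i) = sets (?Z i)"
      and "prob_space (cond_obs_law MZ Q x i)"
      using measurable_space[OF cond_i x] by (auto simp: space_prob_algebra)
    interpret cond: prob_space "cond_obs_law MZ Q x i" by fact
    interpret pair_sigma_finite "cond_obs_law MZ Q x i" P ..
    have "(\<lambda>(z, y). h y z) \<in> borel_measurable (?Z i \<Otimes>\<^sub>M P)"
      using measurable_compose[OF measurable_pair_swap' h] by (simp add: case_prod_beta)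
    then have h': "(\<lambda>(z, y). h y z) \<in> borel_measurable (cond_obs_law MZ Q x i \<Otimes>\<^sub>M P)"
      by (simp add: measurable_cong_sets[OF sets_pair_measure_cong[OF sets_cond refl] refl])
    have "(\<integral>\<^sup>+y. F (x(i := y)) \<partial>P) = (\<integral>\<^sup>+y. \<integral>\<^sup>+z. h y z \<partial>cond_obs_law MZ Q x i \<partial>P)"
      by (intro nn_integral_cong F_upd x)
    also have "\<dots> = (\<integral>\<^sup>+z. \<integral>\<^sup>+y. h y z \<partial>P \<partial>cond_obs_law MZ Q x i)"
      by (rule Fubini'[OF h'])
    finally show "(\<integral>\<^sup>+y. F (x(i := y)) \<partial>P) = (\<integral>\<^sup>+z. \<integral>\<^sup>+y. h y z \<partial>P \<partial>cond_obs_law MZ Q x i)" .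
  qed
  also have "\<dots> = (\<integral>\<^sup>+z. \<integral>\<^sup>+y. h y z \<partial>P \<partial>obs_law MZ i Q P)"
    unfolding obs_law_def
  proof (rule nn_integral_bind[OF _ measurable_prob_algebraD[OF cond_i], symmetric])
    have "(\<lambda>(z, y). h y z) \<in> borel_measurable (?Z i \<Otimes>\<^sub>M P)"
      using measurable_compose[OF measurable_pair_swap' h] by (simp add: case_prod_beta)
    then show "(\<lambda>z. \<integral>\<^sup>+y. h y z \<partial>P) \<in> borel_measurable (?Z i)"
      by (rule P.borel_measurable_nn_integral)
  qed
  also have "\<dots> = (\<integral>\<^sup>+z. \<integral>\<^sup>+w. f w \<partial>marginal_step MZ Q P i z \<partial>obs_law MZ i Q P)"
    using obs_i marg
    by (intro nn_integral_cong) (auto simp: space_prob_algebra dest: sets_eq_imp_space_eq)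
  also have "\<dots> = (\<integral>\<^sup>+w. f w \<partial>(obs_law MZ i Q P \<bind> marginal_step MZ Q P i))"
  proof (rule nn_integral_bind[OF f, symmetric])
    have "sets (obs_law MZ i Q P) = sets (?Z i)"
      using obs_i by (simp add: space_prob_algebra)
    then show "marginal_step MZ Q P i \<in> obs_law MZ i Q P \<rightarrow>\<^sub>M subprob_algebra (?Z (Suc i))"
      using measurable_prob_algebraD[OF marginal_step_measurable[OF Q P i]] measurable_cong_sets
      by blast
  qed
  also have "\<dots> = emeasure (obs_law MZ i Q P \<bind> marginal_step MZ Q P i) A"
    using A sets_bind'[OF obs_i marginal_step_measurable[OF Q P i]] by (simp add: f_def)
  finally show "emeasure (obs_law MZ (Suc i) Q P) A =
      emeasure (obs_law MZ i Q P \<bind> marginal_step MZ Q P i) A" .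
qed

section \<open>Indistinguishability of private samples\<close>

lemma second_moment_bound_marginal_step:
  assumes Q: "Q \<in> renyi2_private_channels MX MZ n \<rho>" and "0 \<le> \<rho>"
    and P: "P \<in> space (prob_algebra MX)" and P': "P' \<in> space (prob_algebra MX)"
    and tv: "\<And>A. A \<in> sets MX \<Longrightarrow> \<bar>measure P A - measure P' A\<bar> \<le> \<delta>"
    and i: "i < n" and z: "z \<in> space (Pi\<^sub>M {..<i} (\<lambda>_. MZ))"
  shows "second_moment_bound (1 + 4 * \<delta>\<^sup>2 * (exp \<rho> - 1))
           (marginal_step MZ Q P i z) (marginal_step MZ Q P' i z)"
proof -
  have Q': "Q \<in> seq_channels MX MZ n"
    using Q by (simp add: renyi2_private_channels_def)
  have K: "(\<lambda>x. Q i x z) \<in> MX \<rightarrow>\<^sub>M prob_algebra MZ"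
    by (rule channel_section_measurable[OF Q' i z])
  have K_simps: "prob_space (Q i x z)" "sets (Q i x z) = sets MZ" if "x \<in> space MX" for x
    using measurable_space[OF K that] by (auto simp: space_prob_algebra)
  have "chi2_bound (exp \<rho> - 1) (Q i x z) (Q i x' z)" if "x \<in> space MX" "x' \<in> space MX" for x x'
    using Q i z that
    by (intro chi2_bound_renyi_div2) (auto simp: renyi2_private_channels_def K_simps)
  then have "chi2_bound (4 * \<delta>\<^sup>2 * (exp \<rho> - 1)) (P \<bind> (\<lambda>x. Q i x z)) (P' \<bind> (\<lambda>x. Q i x z))"
    using \<open>0 \<le> \<rho>\<close> by (intro chi2_bound_mixture[OF P P' K tv]) auto
  then have "second_moment_bound (1 + 4 * \<delta>\<^sup>2 * (exp \<rho> - 1))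
      (P \<bind> (\<lambda>x. Q i x z)) (P' \<bind> (\<lambda>x. Q i x z))"
    using prob_space_bind'[OF P K] prob_space_bind'[OF P' K] sets_bind'[OF P K] sets_bind'[OF P' K]
      \<open>0 \<le> \<rho>\<close> by (intro second_moment_bound_chi2_bound) auto
  then show ?thesis
    unfolding marginal_step_def
    using sets_bind'[OF P K] sets_bind'[OF P' K] append_obs_section_measurable[OF z]
    by (intro second_moment_bound_distr) (auto cong: measurable_cong_sets)
qed

lemma second_moment_bound_obs_law:
  assumes Q: "Q \<in> renyi2_private_channels MX MZ n \<rho>" and \<rho>: "0 \<le> \<rho>"
    and P: "P \<in> space (prob_algebra MX)" and P': "P' \<in> space (prob_algebra MX)"
    and tv: "\<And>A. A \<in> sets MX \<Longrightarrow> \<bar>measure P A - measure P' A\<bar> \<le> \<delta>"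
    and "i \<le> n"
  shows "second_moment_bound ((1 + 4 * \<delta>\<^sup>2 * (exp \<rho> - 1)) ^ i) (obs_law MZ i Q P) (obs_law MZ i Q P')"
  using \<open>i \<le> n\<close>
proof (induction i)
  case 0
  have Q': "Q \<in> seq_channels MX MZ n"
    using Q by (simp add: renyi2_private_channels_def)
  have "prob_space (obs_law MZ 0 Q P')"
    using obs_law_in_prob_algebra[OF Q' P', of 0] by (simp add: space_prob_algebra)
  \<comment> \<open>Before the first round both laws are the point mass at the empty sample.\<close>
  moreover have "obs_law MZ 0 Q P = obs_law MZ 0 Q P'"
    by (simp add: obs_law_def PiM_empty)
  ultimately show ?case
    using second_moment_bound_chi2_bound[of "obs_law MZ 0 Q P'" "obs_law MZ 0 Q P'" 0]
    by (simp add: chi2_bound_def)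
next
  case (Suc i)
  have Q': "Q \<in> seq_channels MX MZ n"
    using Q by (simp add: renyi2_private_channels_def)
  from Suc.prems have i: "i < n" by simp
  then have obs: "obs_law MZ i Q P \<in> space (prob_algebra (Pi\<^sub>M {..<i} (\<lambda>_. MZ)))"
    "obs_law MZ i Q P' \<in> space (prob_algebra (Pi\<^sub>M {..<i} (\<lambda>_. MZ)))"
    using obs_law_in_prob_algebra[OF Q'] P P' by auto
  show ?case
    unfolding obs_law_Suc[OF Q' P i] obs_law_Suc[OF Q' P' i] power_Suc2
    using Suc \<rho> i
    by (intro second_moment_bound_bind[OF obs marginal_step_measurable[OF Q' P i]
          marginal_step_measurable[OF Q' P' i]]
        second_moment_bound_marginal_step[OF Q \<rho> P P' tv i]) auto
qed

text \<open>
  The radius is chosen so that each of the \<open>n\<close> rounds costs a factor of at most \<open>1 + 1/n\<close>, since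
  \<open>exp (\<epsilon>\<^sup>2) - 1 \<le> 2 \<epsilon>\<^sup>2\<close>; the whole sample then costs at most \<open>e\<close>.
\<close>

lemma privacy_budget_le_three:
  fixes \<epsilon> :: real
  assumes n: "1 \<le> n" and \<epsilon>: "0 < \<epsilon>" "\<epsilon> \<le> 1"
  shows "(1 + 4 * (1 / (2 * sqrt (2 * real n * \<epsilon>\<^sup>2)))\<^sup>2 * (exp (\<epsilon>\<^sup>2) - 1)) ^ n \<le> 3"
proof -
  have \<epsilon>2: "0 < \<epsilon>\<^sup>2" "\<epsilon>\<^sup>2 \<le> 1"
    using \<epsilon> by (auto simp: power_le_one)
  \<comment> \<open>Both estimates in this chain rest on \<open>\<epsilon> \<le> 1\<close>.\<close>
  have "exp (\<epsilon>\<^sup>2) - 1 \<le> \<epsilon>\<^sup>2 + (\<epsilon>\<^sup>2)\<^sup>2"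
    using exp_bound[of "\<epsilon>\<^sup>2"] \<epsilon>2 by simp
  also have "(\<epsilon>\<^sup>2)\<^sup>2 \<le> \<epsilon>\<^sup>2"
    using power_decreasing[of 1 2 "\<epsilon>\<^sup>2"] \<epsilon>2 by simp
  finally have e: "exp (\<epsilon>\<^sup>2) - 1 \<le> 2 * \<epsilon>\<^sup>2"
    by simp
  have "4 * (1 / (2 * sqrt (2 * real n * \<epsilon>\<^sup>2)))\<^sup>2 * (exp (\<epsilon>\<^sup>2) - 1)
      = (exp (\<epsilon>\<^sup>2) - 1) / (2 * real n * \<epsilon>\<^sup>2)"
    using n \<epsilon>2 by (simp add: power_divide power_mult_distrib)
  also have "\<dots> \<le> (2 * \<epsilon>\<^sup>2) / (2 * real n * \<epsilon>\<^sup>2)"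
    using e n \<epsilon>2 by (intro divide_right_mono) auto
  also have "\<dots> = 1 / real n"
    using \<epsilon>2 n by (simp add: field_simps)
  finally have le: "4 * (1 / (2 * sqrt (2 * real n * \<epsilon>\<^sup>2)))\<^sup>2 * (exp (\<epsilon>\<^sup>2) - 1) \<le> 1 / real n" .
  have "(1 + 4 * (1 / (2 * sqrt (2 * real n * \<epsilon>\<^sup>2)))\<^sup>2 * (exp (\<epsilon>\<^sup>2) - 1)) ^ n \<le> (exp (1 / real n)) ^ n"
    by (intro power_mono add_nonneg_nonneg mult_nonneg_nonneg
        order_trans[OF add_left_mono[OF le] exp_ge_add_one_self]) auto
  also have "\<dots> = exp 1"
    using n by (simp flip: exp_of_nat_mult)
  also have "\<dots> \<le> 3"
    by (rule exp_le)
  finally show ?thesis .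
qed

section \<open>The two-point lower bound\<close>

text \<open>
  Le Cam's two-point argument without total variation. If \<open>v\<close> takes values in the unit interval and \<open>a\<close> is
  its integral under \<open>\<mu>\<close>, then its integral under \<open>\<nu>\<close> is at least that of \<open>v\<^sup>2\<close>, hence at least
  \<open>a\<^sup>2/3\<close>. So the normalised total loss is at least \<open>1 - a + a\<^sup>2/3\<close>, whose minimum over real \<open>a\<close> is
  \<open>1/4\<close>, attained at \<open>3/2\<close>.
\<close>

lemma quarter_le_two_point:
  assumes "prob_space \<mu>" "prob_space \<nu>" and sets_eq: "sets \<mu> = sets \<nu>"
    and dom: "second_moment_bound 3 \<mu> \<nu>"
    and f [measurable]: "f \<in> borel_measurable \<nu>" and g [measurable]: "g \<in> borel_measurable \<nu>"
    and f0: "\<And>x. 0 \<le> f x" and g0: "\<And>x. 0 \<le> g x"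
    and w: "0 \<le> w" "\<And>x. x \<in> space \<nu> \<Longrightarrow> w \<le> f x + g x"
  shows "ennreal (w / 4) \<le> (\<integral>\<^sup>+x. ennreal (f x) \<partial>\<mu>) + (\<integral>\<^sup>+x. ennreal (g x) \<partial>\<nu>)"
proof (cases "w = 0")
  case False
  with w have "w > 0" by simp
  interpret \<mu>: prob_space \<mu> by fact
  interpret \<nu>: prob_space \<nu> by fact
  have sp: "space \<mu> = space \<nu>"
    using sets_eq sets_eq_imp_space_eq by auto
  have M: "borel_measurable \<mu> = (borel_measurable \<nu> :: ('a \<Rightarrow> real) set)"
    by (rule measurable_cong_sets[OF sets_eq refl])
  \<comment> \<open>The best split of the loss \<open>w\<close> that \<open>f\<close> allows: \<open>f \<ge> w (1 - v)\<close> and \<open>g \<ge> w v\<close>.\<close>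
  define v where "v x = 1 - min (f x / w) 1" for x
  have v [measurable]: "v \<in> borel_measurable \<nu>"
    unfolding v_def by measurable
  then have v' [measurable]: "v \<in> borel_measurable \<mu>"
    by (simp add: M)
  have v01: "0 \<le> v x" "v x \<le> 1" for x
    using f0[of x] \<open>w > 0\<close> by (auto simp: v_def min_def field_simps)
  have bdd: "bounded (v ` S)" for S
    unfolding bounded_iff using v01 by (intro exI[of _ 1]) auto
  have int_v: "integrable \<nu> v" "integrable \<mu> v" "integrable \<nu> (\<lambda>x. (v x)\<^sup>2)"
    using \<nu>.integrable_bounded_image[OF v bdd] \<mu>.integrable_bounded_image[OF v' bdd]
      \<nu>.integrable_bounded_image[OF _ bounded_image_power2[OF bdd]] by auto
  define a where "a = integral\<^sup>L \<mu> v"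
  have "a\<^sup>2 \<le> 3 * (\<integral>x. (v x)\<^sup>2 \<partial>\<nu>)"
    using dom v bdd by (auto simp: second_moment_bound_def a_def)
  also have "(\<integral>x. (v x)\<^sup>2 \<partial>\<nu>) \<le> integral\<^sup>L \<nu> v"
    using int_v v01 by (intro integral_mono) (auto simp: power2_eq_square mult_left_le)
  finally have "a\<^sup>2 / 3 \<le> integral\<^sup>L \<nu> v" by simp
  moreover have "1 / 4 \<le> 1 - a + a\<^sup>2 / 3"
    using zero_le_power2[of "2 * a - 3"] by (simp add: power2_eq_square algebra_simps)
  ultimately have "1 / 4 \<le> 1 - a + integral\<^sup>L \<nu> v"
    by linarith
  then have "w * (1 / 4) \<le> w * (1 - a + integral\<^sup>L \<nu> v)"
    using \<open>w > 0\<close> by (intro mult_left_mono) auto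
  then have "w / 4 \<le> (\<integral>x. w * (1 - v x) \<partial>\<mu>) + (\<integral>x. w * v x \<partial>\<nu>)"
    using int_v by (simp add: a_def \<mu>.prob_space algebra_simps)
  then have "ennreal (w / 4) \<le> ennreal (\<integral>x. w * (1 - v x) \<partial>\<mu>) + ennreal (\<integral>x. w * v x \<partial>\<nu>)"
    using v01 w(1) by (metis (no_types, lifting) Bochner_Integration.integral_nonneg
        diff_ge_0_iff_ge ennreal_leI ennreal_plus mult_nonneg_nonneg)
  also have "ennreal (\<integral>x. w * (1 - v x) \<partial>\<mu>) = (\<integral>\<^sup>+x. ennreal (w * (1 - v x)) \<partial>\<mu>)"
    using int_v v01 w(1) by (subst nn_integral_eq_integral) auto
  also have "ennreal (\<integral>x. w * v x \<partial>\<nu>) = (\<integral>\<^sup>+x. ennreal (w * v x) \<partial>\<nu>)"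
    using int_v v01 w(1) by (subst nn_integral_eq_integral) auto
  also have "(\<integral>\<^sup>+x. ennreal (w * (1 - v x)) \<partial>\<mu>) + (\<integral>\<^sup>+x. ennreal (w * v x) \<partial>\<nu>)
      \<le> (\<integral>\<^sup>+x. ennreal (f x) \<partial>\<mu>) + (\<integral>\<^sup>+x. ennreal (g x) \<partial>\<nu>)"
  proof (intro add_mono nn_integral_mono ennreal_leI)
    fix x
    show "w * (1 - v x) \<le> f x"
      using \<open>w > 0\<close> by (auto simp: v_def min_def field_simps)
    assume "x \<in> space \<nu>"
    then show "w * v x \<le> g x"
      using \<open>w > 0\<close> w(2)[of x] g0[of x] by (auto simp: v_def min_def field_simps)
  qed
  finally show ?thesis .
qed simp

text \<open>
  No estimate can be good for both parameters. For a convex loss Jensen's inequality gains a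
  factor of two over the quasiconvex case, and this is what \<open>c_conv\<close> records.
\<close>

lemma loss_separation:
  fixes L :: "'a::real_vector \<Rightarrow> real"
  assumes nonneg: "\<And>t. 0 \<le> L t" and sym: "\<And>t. L (- t) = L t" and qc: "quasiconvex L"
  shows "2 / c_conv L * L ((a - b) /\<^sub>R 2) \<le> L (t - a) + L (t - b)"
proof -
  \<comment> \<open>The half difference is the midpoint of the two errors, one of them reflected.\<close>
  have mid: "(a - b) /\<^sub>R 2 = (1 - 1/2) *\<^sub>R (- (t - a)) + (1/2) *\<^sub>R (t - b)"
    by (simp add: algebra_simps scaleR_2 flip: scaleR_add_left)
  show ?thesis
  proof (cases "convex_on UNIV L")
    case True
    then have "L ((a - b) /\<^sub>R 2) \<le> (1 - 1/2) * L (- (t - a)) + (1/2) * L (t - b)"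
      unfolding mid by (intro convex_onD) auto
    then show ?thesis
      using True sym[of "t - a"] by (simp add: c_conv_def)
  next
    case False
    have "L ((a - b) /\<^sub>R 2) \<le> max (L (- (t - a))) (L (t - b))"
      unfolding mid using qc[unfolded quasiconvex_def, rule_format, of "1/2"] by simp
    then show ?thesis
      using False sym[of "t - a"] nonneg[of "t - a"] nonneg[of "t - b"] by (simp add: c_conv_def)
  qed
qed

lemma max_risk_lower_bound:
  fixes L :: "real ^ 'd \<Rightarrow> real" and \<theta> :: "'x measure \<Rightarrow> real ^ 'd"
  assumes L_measurable: "L \<in> borel_measurable borel"
    and L: "\<And>t. 0 \<le> L t" "\<And>t. L (- t) = L t" "quasiconvex L"
    and P0: "P0 \<in> space (prob_algebra MX)" and P1: "P1 \<in> space (prob_algebra MX)"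
    and n: "1 \<le> n" and \<epsilon>: "0 < \<epsilon>" "\<epsilon> \<le> 1"
    and tv: "tv_dist P1 P0 \<le> 1 / (2 * sqrt (2 * real n * \<epsilon>\<^sup>2))"
    and est: "est \<in> Pi\<^sub>M {..<n} (\<lambda>_. MZ) \<rightarrow>\<^sub>M borel"
    and Q: "Q \<in> renyi2_private_channels MX MZ n (\<epsilon>\<^sup>2)"
  shows "ennreal (1 / (4 * c_conv L)) * ennreal (L ((\<theta> P0 - \<theta> P1) /\<^sub>R 2))
    \<le> max (risk MZ n \<theta> L est Q P0) (risk MZ n \<theta> L est Q P1)"
proof -
  let ?\<delta> = "1 / (2 * sqrt (2 * real n * \<epsilon>\<^sup>2))" and ?Z = "Pi\<^sub>M {..<n} (\<lambda>_. MZ)"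
  have Q': "Q \<in> seq_channels MX MZ n"
    using Q by (simp add: renyi2_private_channels_def)
  have obs: "prob_space (obs_law MZ n Q P)" "sets (obs_law MZ n Q P) = sets ?Z"
    if "P \<in> space (prob_algebra MX)" for P
    using obs_law_in_prob_algebra[OF Q' that order_refl] by (auto simp: space_prob_algebra)
  have "\<bar>measure P1 A - measure P0 A\<bar> \<le> ?\<delta>" if "A \<in> sets MX" for A
    using abs_measure_diff_le_tv_dist[of P1 P0 A] P0 P1 that tv by (auto simp: space_prob_algebra)
  from second_moment_bound_obs_law[OF Q _ P1 P0 this order_refl]
  have "second_moment_bound ((1 + 4 * ?\<delta>\<^sup>2 * (exp (\<epsilon>\<^sup>2) - 1)) ^ n)
      (obs_law MZ n Q P1) (obs_law MZ n Q P0)"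
    by simp
  then have dom: "second_moment_bound 3 (obs_law MZ n Q P1) (obs_law MZ n Q P0)"
    by (rule second_moment_bound_mono[OF privacy_budget_le_three[OF n \<epsilon>]])
  define \<omega> where "\<omega> = L ((\<theta> P0 - \<theta> P1) /\<^sub>R 2)"
  define w where "w = 2 / c_conv L * \<omega>"
  have c: "c_conv L > 0" and \<omega>: "0 \<le> \<omega>"
    by (simp_all add: c_conv_def \<omega>_def L(1))
  have meas: "(\<lambda>z. L (est z - a)) \<in> borel_measurable (obs_law MZ n Q P0)" for a
  proof -
    have "(\<lambda>z. est z - a) \<in> ?Z \<rightarrow>\<^sub>M borel"
      using est by measurable
    from measurable_compose[OF this L_measurable] show ?thesis
      by (simp add: measurable_cong_sets[OF obs(2)[OF P0] refl])
  qed
  have "ennreal (w / 4) \<le> risk MZ n \<theta> L est Q P1 + risk MZ n \<theta> L est Q P0"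
    unfolding risk_def
  proof (rule quarter_le_two_point)
    show "0 \<le> w"
      using c \<omega> by (simp add: w_def)
    show "w \<le> L (est z - \<theta> P1) + L (est z - \<theta> P0)" for z
      using loss_separation[OF L, of "\<theta> P0" "\<theta> P1" "est z"] by (simp add: w_def \<omega>_def)
  qed (use obs P0 P1 dom meas L(1) in auto)
  also have "\<dots> \<le> 2 * max (risk MZ n \<theta> L est Q P0) (risk MZ n \<theta> L est Q P1)"
    unfolding mult_2 by (intro add_mono) auto
  finally have "ennreal (1 / 2) * ennreal (w / 4) \<le>
      ennreal (1 / 2) * (2 * max (risk MZ n \<theta> L est Q P0) (risk MZ n \<theta> L est Q P1))"
    by (rule mult_left_mono) simp
  also have "\<dots> = max (risk MZ n \<theta> L est Q P0) (risk MZ n \<theta> L est Q P1)"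
  proof -
    have "ennreal (1 / 2) * 2 = ennreal (1 / 2 * 2)"
      by (subst ennreal_mult) auto
    then show ?thesis
      by (simp only: mult.assoc[symmetric]) simp
  qed
  also have "ennreal (1 / 2) * ennreal (w / 4) = ennreal (1 / 2 * (w / 4))"
    using c \<omega> by (subst ennreal_mult) (auto simp: w_def)
  also have "1 / 2 * (w / 4) = 1 / (4 * c_conv L) * \<omega>"
    using c by (simp add: w_def)
  also have "ennreal \<dots> = ennreal (1 / (4 * c_conv L)) * ennreal \<omega>"
    using c \<omega> by (subst ennreal_mult) auto
  finally show ?thesis
    by (simp only: \<omega>_def)
qed

theorem theorem1:
  fixes MX :: "'x measure" and MZ :: "'z measure"
    and \<P> :: "'x measure set" and P0 :: "'x measure"
    and \<Theta> :: "(real ^ 'd) set" and \<theta> :: "'x measure \<Rightarrow> real ^ 'd"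
    and L :: "real ^ 'd \<Rightarrow> real" and \<epsilon> :: real and n :: nat
  assumes L_measurable: "L \<in> borel_measurable borel"
    and L_nonneg: "\<And>t. 0 \<le> L t"
    and L_symmetric: "\<And>t. L (- t) = L t"
    and L_quasiconvex: "quasiconvex L"
    and L_zero: "L 0 = 0"
    and family: "\<P> \<subseteq> space (prob_algebra MX)"
    and parameter: "\<theta> \<in> \<P> \<rightarrow> \<Theta>"
    and P0: "P0 \<in> \<P>"
    and n: "1 \<le> n"
    and \<epsilon>: "0 < \<epsilon>" "\<epsilon> \<le> 1"
  shows "local_minimax_risk MZ n \<theta> P0 L \<P> (renyi2_private_channels MX MZ n (\<epsilon>\<^sup>2))
           \<ge> ennreal (1 / (4 * c_conv L)) *
             modulus \<theta> L (1 / (2 * sqrt (2 * real n * \<epsilon>\<^sup>2))) P0 \<P>"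
proof -
  let ?\<delta> = "1 / (2 * sqrt (2 * real n * \<epsilon>\<^sup>2))"
  have "ennreal (1 / (4 * c_conv L)) * ennreal (L ((\<theta> P0 - \<theta> P1) /\<^sub>R 2))
      \<le> local_minimax_risk MZ n \<theta> P0 L \<P> (renyi2_private_channels MX MZ n (\<epsilon>\<^sup>2))"
    if P1: "P1 \<in> \<P>" "tv_dist P1 P0 \<le> ?\<delta>" for P1
    unfolding local_minimax_risk_def
  proof (rule SUP_upper2[OF P1(1)], rule INF_greatest, clarify)
    fix est :: "(nat \<Rightarrow> 'z) \<Rightarrow> real ^ 'd" and Q :: "('x, 'z) channel"
    assume "est \<in> Pi\<^sub>M {..<n} (\<lambda>_. MZ) \<rightarrow>\<^sub>M borel"
      and "Q \<in> renyi2_private_channels MX MZ n (\<epsilon>\<^sup>2)"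
    then show "ennreal (1 / (4 * c_conv L)) * ennreal (L ((\<theta> P0 - \<theta> P1) /\<^sub>R 2))
        \<le> max (risk MZ n \<theta> L est Q P0) (risk MZ n \<theta> L est Q P1)"
      using P0 P1 family L_nonneg L_symmetric
      by (intro max_risk_lower_bound[OF L_measurable _ _ L_quasiconvex _ _ n \<epsilon>]) auto
  qed
  then show ?thesis
    unfolding modulus_def by (auto simp: SUP_mult_left_ennreal intro!: SUP_least)
qed

end
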